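(* Let $K\ge 2$ be an integer, let $i\in\{1,\dots,K\}$, let $\alpha_t\ge 0$ be a real number, and let $\mathbf{x}$ be a random vector in the simplex $\mathbb{S}_K$ with $\mathbf{x}\sim \mathrm{Dir}(\mathbf{1}+\alpha_t \mathbf{e}_i)$. Then the Voronoi probability $P_{v_i}(\mathbf{x}\mid \mathbf{e}_i)=P(\mathbf{x}\in\mathbb{V}_i)$ equals $$P_{v_i}(\mathbf{x}\mid \mathbf{e}_i)=\sum_{k=0}^{K-1}\frac{(-1)^k\binom{K-1}{k}}{(k+1)^{\alpha_t+1}}.$$
   Context: $\mathbb{S}_K=\{\mathbf{x}\in\mathbb{R}^K : \sum_{j=1}^K x_j=1,\ x_j>0\ \forall j\}$ is the probability simplex, $\mathbf{e}_j$ is the $j$-th standard basis vector of $\mathbb{R}^K$, and $\mathbf{1}\in\mathbb{R}^K$ is the all-ones vector. For $\boldsymbol{\alpha}\in\mathbb{R}_{>0}^K$, $\mathrm{Dir}(\boldsymbol{\alpha})$ is the Dirichlet distribution on $\mathbb{S}_K$ with density $\mathrm{B}(\boldsymbol{\alpha})^{-1}\prod_{j=1}^K x_j^{\alpha_j-1}$, where $\mathrm{B}(\boldsymbol{\alpha})=\prod_{j=1}^K\Gamma(\alpha_j)\big/\Gamma\big(\sum_{j=1}^K\alpha_j\big)$. So $\mathrm{Dir}(\mathbf{1}+\alpha_t\mathbf{e}_i)$ has all parameters equal to $1$ except the $i$-th, which equals $1+\alpha_t$. The Voronoi region of vertex $i$ is $\mathbb{V}_i=\{\mathbf{x}\in\mathbb{S}_K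 : d(\mathbf{x},\mathbf{e}_i)\le d(\mathbf{x},\mathbf{e}_j)\ \forall j\ne i\}$, with $d$ the Euclidean distance. The Voronoi probability $P_{v_i}(\mathbf{x}\mid\mathbf{e}_i)$ is the probability that $\mathbf{x}\in\mathbb{V}_i$ when $\mathbf{x}$ is drawn from the noising distribution $\mathrm{Dir}(\mathbf{1}+\alpha_t\mathbf{e}_i)$ started from the clean vertex $\mathbf{e}_i$. *)

theory Defs
  imports "HOL-Probability.Probability"
begin

text \<open>
  Vectors of \<open>\<real>\<^sup>K\<close> are functions in \<open>{1..K} \<rightarrow>\<^sub>E UNIV\<close>, the carrier of the product
  space \<open>Pi\<^sub>M {1..K} (\<lambda>_. borel)\<close>.
\<close>

definition std_basis :: "nat \<Rightarrow> nat \<Rightarrow> (nat \<Rightarrow> real)" where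
  "std_basis K j = (\<lambda>l\<in>{1..K}. if l = j then 1 else 0)"

definition euclidean_distance :: "nat \<Rightarrow> (nat \<Rightarrow> real) \<Rightarrow> (nat \<Rightarrow> real) \<Rightarrow> real" where
  "euclidean_distance K x y = L2_set (\<lambda>l. x l - y l) {1..K}"

definition prob_simplex :: "nat \<Rightarrow> (nat \<Rightarrow> real) set" where
  "prob_simplex K =
     {x \<in> {1..K} \<rightarrow>\<^sub>E UNIV. (\<Sum>j=1..K. x j) = 1 \<and> (\<forall>j\<in>{1..K}. 0 < x j)}"

text \<open>
  The simplex is a null set of \<open>\<real>\<^sup>K\<close>, so the Dirichlet density is taken, as usual, with
  respect to Lebesgue measure in the first \<open>K - 1\<close> coordinates. The measure below
  is the image of that Lebesgue measure on the hyperplane of vectors with coordinate sum 1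
  (\<open>K \<ge> 1\<close> is intended).
\<close>

definition simplex_lborel :: "nat \<Rightarrow> (nat \<Rightarrow> real) measure" where
  "simplex_lborel K =
     distr (Pi\<^sub>M {1..<K} (\<lambda>_. lborel)) (Pi\<^sub>M {1..K} (\<lambda>_. borel))
       (\<lambda>y. y(K := 1 - (\<Sum>j=1..<K. y j)))"

definition multivariate_Beta :: "nat \<Rightarrow> (nat \<Rightarrow> real) \<Rightarrow> real" where
  "multivariate_Beta K \<alpha> = (\<Prod>j=1..K. Gamma (\<alpha> j)) / Gamma (\<Sum>j=1..K. \<alpha> j)"

definition dirichlet_density :: "nat \<Rightarrow> (nat \<Rightarrow> real) \<Rightarrow> (nat \<Rightarrow> real) \<Rightarrow> real" where
  "dirichlet_density K \<alpha> x =
     (if x \<in> prob_simplex K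
      then inverse (multivariate_Beta K \<alpha>) * (\<Prod>j=1..K. x j powr (\<alpha> j - 1))
      else 0)"

definition voronoi_region :: "nat \<Rightarrow> nat \<Rightarrow> (nat \<Rightarrow> real) set" where
  "voronoi_region K i =
     {x \<in> prob_simplex K. \<forall>j\<in>{1..K} - {i}.
        euclidean_distance K x (std_basis K i) \<le> euclidean_distance K x (std_basis K j)}"

end

theory Submission
  imports Defs
begin

text \<open>
  The Voronoi region of vertex \<open>i\<close> is the part of the simplex where \<open>x\<^sub>i\<close> is the largest coordinate.
  Fix \<open>x\<^sub>i = u\<close> and eliminate some other coordinate instead of the last one. The remaining
  \<open>K - 2\<close> coordinates range over a slice of the cube \<open>(0, u]\<^sup>K\<^sup>-\<^sup>1\<close> by a hyperplane of coordinate sum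
  \<open>1 - u\<close>, whose volume is, by inclusion-exclusion over the coordinates exceeding \<open>u\<close>,
  \<open>1/(K-2)! \<Sum>\<^sub>k (-1)\<^sup>k (K-1 choose k) (1 - (k+1) u)\<^sub>+\<^sup>K\<^sup>-\<^sup>2\<close>. Integrating it against \<open>u\<^sup>a\<close> gives, term by term
  after scaling \<open>u\<close> by \<open>k + 1\<close>, one and the same Beta integral, which cancels
  the normalizing constant of the Dirichlet density.
\<close>

section \<open>Lebesgue measure on the simplex and the shape of the Voronoi region\<close>

lemma sum_fun_upd_insert:
  fixes y :: "'i \<Rightarrow> 'b :: comm_monoid_add"
  assumes "finite J" "m \<notin> J"
  shows "(\<Sum>j\<in>insert m J. (y(m := u)) j) = u + (\<Sum>j\<in>J. y j)"
proof -
  have "(\<Sum>j\<in>J. (y(m := u)) j) = (\<Sum>j\<in>J. y j)"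
    using assms(2) by (intro sum.cong) auto
  then show ?thesis
    by (simp only: sum.insert[OF assms] fun_upd_same)
qed

text \<open>The definition of \<open>simplex_lborel\<close> singles out coordinate \<open>K\<close>,
  but the measure is symmetric: trading the eliminated coordinate \<open>K\<close> for
  \<open>r\<close> is a reflection of the real line once all other coordinates are fixed. This
  allows \<open>x i\<close> to stay a free variable even when \<open>i = K\<close>.\<close>

lemma nn_integral_simplex_lborel:
  assumes r: "r \<in> {1..K}"
    and F [measurable]: "F \<in> borel_measurable (Pi\<^sub>M {1..K} (\<lambda>_. borel))"
  shows "(\<integral>\<^sup>+x. F x \<partial>simplex_lborel K) =
    (\<integral>\<^sup>+y. F (y(r := 1 - (\<Sum>j\<in>{1..K}-{r}. y j))) \<partial>Pi\<^sub>M ({1..K}-{r}) (\<lambda>_. lborel))"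
proof -
  interpret product_sigma_finite "\<lambda>_::nat. lborel :: real measure" ..
  have meas: "(\<lambda>y. F (y(m := 1 - (\<Sum>j\<in>I. y j)))) \<in> borel_measurable (Pi\<^sub>M I (\<lambda>_. lborel))"
    if "insert m I = {1..K}" for m I
  proof -
    have 1: "(\<lambda>y. y(m := 1 - (\<Sum>j\<in>I. y j))) \<in> Pi\<^sub>M I (\<lambda>_. lborel) \<rightarrow>\<^sub>M Pi\<^sub>M {1..K} (\<lambda>_. borel)"
      by (rule measurable_fun_upd[where J = I]) (use that in \<open>auto intro!: measurable_PiM_single'\<close>)
    show ?thesis
      using measurable_compose[OF 1 F] .
  qed
  have last: "(\<integral>\<^sup>+x. F x \<partial>simplex_lborel K) =
      (\<integral>\<^sup>+y. F (y(K := 1 - (\<Sum>j\<in>{1..<K}. y j))) \<partial>Pi\<^sub>M {1..<K} (\<lambda>_. lborel))"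
  proof -
    have "(\<lambda>y. y(K := 1 - (\<Sum>j\<in>{1..<K}. y j)))
        \<in> Pi\<^sub>M {1..<K} (\<lambda>_. lborel) \<rightarrow>\<^sub>M Pi\<^sub>M {1..K} (\<lambda>_. borel)"
      by (rule measurable_fun_upd[where J = "{1..<K}"])
        (use r in \<open>auto intro!: measurable_PiM_single'\<close>)
    then show ?thesis
      unfolding simplex_lborel_def by (subst nn_integral_distr) (use F in simp_all)
  qed
  show ?thesis
  proof (cases "r = K")
    case True
    then have "{1..K} - {r} = {1..<K}" by auto
    with True last show ?thesis by simp
  next
    case False
    \<comment> \<open>The coordinates shared by both parametrizations; each side has exactly one
      further free variable, \<open>r\<close> on the left and \<open>K\<close> on the right.\<close>
    define J where "J = {1..K} - {r, K}"
    have J: "finite J" "r \<notin> J" "K \<notin> J" "{1..<K} = insert r J" "{1..K} - {r} = insert K J"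
        "insert r (insert K J) = {1..K}" "insert K (insert r J) = {1..K}"
      using r False by (auto simp: J_def)
    \<comment> \<open>Substitute \<open>u = (1 - ?S) - v\<close>. The slope -1 has absolute value 1,
      so no Jacobian factor appears.\<close>
    have inner: "(\<integral>\<^sup>+u. F (y(r := u, K := 1 - u - (\<Sum>j\<in>J. y j))) \<partial>lborel) =
        (\<integral>\<^sup>+v. F (y(K := v, r := 1 - v - (\<Sum>j\<in>J. y j))) \<partial>lborel)"
      if y: "y \<in> space (Pi\<^sub>M J (\<lambda>_. lborel))" for y :: "nat \<Rightarrow> real"
    proof -
      let ?S = "\<Sum>j\<in>J. y j"
      have "(\<lambda>u::real. y(r := u)) \<in> borel \<rightarrow>\<^sub>M Pi\<^sub>M (insert r J) (\<lambda>_. borel)"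
        by (rule measurable_fun_upd[where J = J]) (use y in \<open>auto simp: space_PiM\<close>)
      then have 1: "(\<lambda>u. y(r := u, K := 1 - u - ?S)) \<in> borel \<rightarrow>\<^sub>M Pi\<^sub>M {1..K} (\<lambda>_. borel)"
        by (rule measurable_fun_upd[rotated]) (use J in auto)
      have "(\<integral>\<^sup>+u. F (y(r := u, K := 1 - u - ?S)) \<partial>lborel) =
          (\<integral>\<^sup>+v. F (y(r := (1 - ?S) + (-1) * v, K := 1 - ((1 - ?S) + (-1) * v) - ?S)) \<partial>lborel)"
        by (subst nn_integral_real_affine[OF measurable_compose[OF 1 F], of "-1" "1 - ?S"]) auto
      also have "\<dots> = (\<integral>\<^sup>+v. F (y(K := v, r := 1 - v - ?S)) \<partial>lborel)"
        using False by (simp add: fun_upd_twist algebra_simps)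
      finally show ?thesis .
    qed
    have "(\<integral>\<^sup>+x. F x \<partial>simplex_lborel K) =
        (\<integral>\<^sup>+y. F (y(K := 1 - (\<Sum>j\<in>insert r J. y j))) \<partial>Pi\<^sub>M (insert r J) (\<lambda>_. lborel))"
      unfolding last J(4) ..
    also have "\<dots> = (\<integral>\<^sup>+y. (\<integral>\<^sup>+u. F (y(r := u, K := 1 - (\<Sum>j\<in>insert r J. (y(r := u)) j))) \<partial>lborel)
        \<partial>Pi\<^sub>M J (\<lambda>_. lborel))"
      by (rule product_nn_integral_insert[OF J(1,2) meas[OF J(7)]])
    also have "\<dots> = (\<integral>\<^sup>+y. (\<integral>\<^sup>+u. F (y(r := u, K := 1 - u - (\<Sum>j\<in>J. y j))) \<partial>lborel)
        \<partial>Pi\<^sub>M J (\<lambda>_. lborel))"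
      by (simp only: sum_fun_upd_insert[OF J(1,2)] diff_diff_eq)
    also have "\<dots> = (\<integral>\<^sup>+y. (\<integral>\<^sup>+v. F (y(K := v, r := 1 - v - (\<Sum>j\<in>J. y j))) \<partial>lborel)
        \<partial>Pi\<^sub>M J (\<lambda>_. lborel))"
      by (rule nn_integral_cong) (rule inner)
    also have "\<dots> = (\<integral>\<^sup>+y. (\<integral>\<^sup>+v. F (y(K := v, r := 1 - (\<Sum>j\<in>insert K J. (y(K := v)) j))) \<partial>lborel)
        \<partial>Pi\<^sub>M J (\<lambda>_. lborel))"
      by (simp only: sum_fun_upd_insert[OF J(1,3)] diff_diff_eq)
    also have "\<dots> = (\<integral>\<^sup>+y. F (y(r := 1 - (\<Sum>j\<in>insert K J. y j))) \<partial>Pi\<^sub>M (insert K J) (\<lambda>_. lborel))"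
      by (rule product_nn_integral_insert[OF J(1,3) meas[OF J(6)], symmetric])
    finally show ?thesis by (simp only: J(5))
  qed
qed

text \<open>The squared distance from \<open>x\<close> to the \<open>j\<close>-th vertex is
  \<open>|x|^2 + 1 - 2 * x j\<close>, so only the term in \<open>x j\<close> depends on the vertex,
  and the nearest vertex belongs to the largest coordinate.\<close>

lemma voronoi_region_eq:
  assumes "i \<in> {1..K}"
  shows "voronoi_region K i = {x \<in> prob_simplex K. \<forall>j\<in>{1..K}. x j \<le> x i}"
proof -
  have dist: "euclidean_distance K x (std_basis K j) = sqrt ((\<Sum>l=1..K. (x l)\<^sup>2) + 1 - 2 * x j)"
    if "j \<in> {1..K}" for x j
  proof -
    have "(\<Sum>l=1..K. (x l - std_basis K j l)\<^sup>2) =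
        (\<Sum>l=1..K. (x l)\<^sup>2 + (if l = j then 1 - 2 * x j else 0))"
      by (rule sum.cong) (auto simp: std_basis_def power2_eq_square algebra_simps)
    also have "\<dots> = (\<Sum>l=1..K. (x l)\<^sup>2) + 1 - 2 * x j"
      using that by (simp add: sum.distrib)
    finally show ?thesis
      by (simp add: euclidean_distance_def L2_set_def)
  qed
  show ?thesis
    unfolding voronoi_region_def using assms by (auto simp: dist)
qed

section \<open>Truncated powers and volumes of cube slices\<close>

text \<open>
  For \<open>n = 0\<close> this is the indicator of \<open>(0, \<infinity>)\<close>, unlike \<open>max x 0 ^ 0\<close>.
\<close>

definition pos_power :: "nat \<Rightarrow> real \<Rightarrow> real" where
  "pos_power n x = (if x > 0 then x ^ n else 0)"

lemma pos_power_Suc: "pos_power (Suc n) x = max x 0 ^ Suc n"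
  by (auto simp: pos_power_def max_def)

lemma has_integral_pos_power:
  assumes "t \<ge> 0"
  shows "((\<lambda>u. pos_power n (c - u)) has_integral
    (pos_power (Suc n) c - pos_power (Suc n) (c - t)) / Suc n) {0..t}"
proof -
  let ?F = "\<lambda>u. - pos_power (Suc n) (c - u) / Suc n"
  have "((\<lambda>u. pos_power n (c - u)) has_integral (?F t - ?F 0)) {0..t}"
  \<comment> \<open>The antiderivative is continuous, but for \<open>n = 0\<close> it has a kink at
    \<open>u = c\<close>, so this point is excepted.\<close>
  proof (rule fundamental_theorem_of_calculus_interior_strong[where S = "{c}"])
    show "continuous_on {0..t} ?F"
      unfolding pos_power_Suc by (intro continuous_intros) auto
    fix x assume x: "x \<in> {0<..<t} - {c}"
    have "(?F has_real_derivative pos_power n (c - x)) (at x)"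
    proof (cases "x < c")
      case True
      have deriv: "((\<lambda>u. - ((c - u) ^ Suc n) / Suc n) has_real_derivative (c - x) ^ n) (at x)"
        by (rule derivative_eq_intros refl | simp del: power_Suc)+
      have "\<forall>\<^sub>F u in nhds x. u \<in> {..<c}"
        by (rule eventually_nhds_in_open) (use True in auto)
      then have "eventually (\<lambda>u. ?F u = - ((c - u) ^ Suc n) / Suc n) (nhds x)"
        by eventually_elim (auto simp: pos_power_def)
      from DERIV_cong_ev[OF refl this refl] deriv show ?thesis
        using True by (simp only: pos_power_def) simp
    next
      case False
      have "\<forall>\<^sub>F u in nhds x. u \<in> {c<..}"
        by (rule eventually_nhds_in_open) (use False x in auto)
      then have "eventually (\<lambda>u. ?F u = 0) (nhds x)"
        by eventually_elim (auto simp: pos_power_def)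
      from DERIV_cong_ev[OF refl this refl] have "(?F has_real_derivative 0) (at x)"
        by simp
      then show ?thesis
        using False by (simp add: pos_power_def)
    qed
    then show "(?F has_vector_derivative pos_power n (c - x)) (at x)"
      by (simp add: has_real_derivative_iff_has_vector_derivative)
  qed (use assms in auto)
  then show ?thesis by (simp add: diff_divide_distrib)
qed

text \<open>
  The volume of the slice \<open>\<Sum>y = s\<close> of the cube \<open>(0, t]\<^sup>n\<^sup>+\<^sup>1\<close>, projected along one coordinate.
\<close>

definition cube_slice :: "nat \<Rightarrow> real \<Rightarrow> real \<Rightarrow> real" where
  "cube_slice n t s =
    (\<Sum>k\<le>Suc n. (-1) ^ k * real (Suc n choose k) * pos_power n (s - real k * t)) / fact n"

text \<open>Difference of two unit steps, at 0 and at \<open>t\<close>. The strict inequality in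
  \<open>pos_power\<close> produces the half-open interval; this is the base case for the induction
  on dimension.\<close>

lemma cube_slice_0: "t \<ge> 0 \<Longrightarrow> cube_slice 0 t s = indicator {0<..t} s"
  by (auto simp: cube_slice_def pos_power_def indicator_def)

text \<open>Pascal's rule splits each coefficient in two; shifting the index in one half turns the
  sum into one over differences of \<open>f\<close>. Integration of truncated powers produces just
  such differences.\<close>

lemma alternating_sum_pascal:
  fixes f :: "nat \<Rightarrow> 'a :: comm_ring_1"
  shows "(\<Sum>k\<le>Suc n. (-1) ^ k * of_nat (Suc n choose k) * f k) =
    (\<Sum>k\<le>n. (-1) ^ k * of_nat (n choose k) * (f k - f (Suc k)))"
proof -
  have "(\<Sum>k\<le>Suc n. (-1) ^ k * of_nat (Suc n choose k) * f k) =
      f 0 + (\<Sum>k\<le>n. (-1) ^ Suc k * of_nat (n choose Suc k) * f (Suc k))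
        - (\<Sum>k\<le>n. (-1) ^ k * of_nat (n choose k) * f (Suc k))"
  proof -
    have "(-1) ^ Suc k * of_nat (Suc n choose Suc k) * f (Suc k) =
        (-1) ^ Suc k * of_nat (n choose Suc k) * f (Suc k) - (-1) ^ k * of_nat (n choose k) * f (Suc k)" for k
      by (simp add: algebra_simps)
    then show ?thesis
      unfolding sum.atMost_Suc_shift by (simp only: sum_subtractf) simp
  qed
  \<comment> \<open>Undoing the index shift extends the range to \<open>Suc n\<close>; the top term
    carries \<open>n choose Suc n = 0\<close> and is dropped next.\<close>
  also have "f 0 + (\<Sum>k\<le>n. (-1) ^ Suc k * of_nat (n choose Suc k) * f (Suc k)) =
      (\<Sum>k\<le>Suc n. (-1) ^ k * of_nat (n choose k) * f k)"
    by (subst sum.atMost_Suc_shift) simp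
  also have "\<dots> = (\<Sum>k\<le>n. (-1) ^ k * of_nat (n choose k) * f k)"
    by (simp add: binomial_eq_0)
  finally show ?thesis
    by (simp only: sum_subtractf right_diff_distrib)
qed

text \<open>Integrating the \<open>k\<close>-th term gives the difference of truncated powers at
  \<open>k * t\<close> and \<open>Suc k * t\<close>. Pascal's rule recombines these into the next
  slice formula, and the factor \<open>1 / Suc n\<close> completes the factorial.\<close>

lemma has_integral_cube_slice:
  assumes "t \<ge> 0"
  shows "((\<lambda>u. cube_slice n t (s - u)) has_integral cube_slice (Suc n) t s) {0..t}"
proof -
  let ?G = "\<lambda>k. (-1) ^ k * real (Suc n choose k) *
    ((pos_power (Suc n) (s - real k * t) - pos_power (Suc n) (s - real (Suc k) * t)) / Suc n)"
  have "((\<lambda>u. cube_slice n t (s - u)) has_integral (\<Sum>k\<le>Suc n. ?G k) / fact n) {0..t}"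
    unfolding cube_slice_def
  proof (intro has_integral_divide has_integral_sum has_integral_mult_right)
    fix k
    show "((\<lambda>u. pos_power n (s - u - real k * t)) has_integral
      ((pos_power (Suc n) (s - real k * t) - pos_power (Suc n) (s - real (Suc k) * t)) / Suc n)) {0..t}"
      using has_integral_pos_power[OF assms, of n "s - real k * t"] by (simp add: algebra_simps)
  qed auto
  also have "(\<Sum>k\<le>Suc n. ?G k) / fact n = cube_slice (Suc n) t s"
    unfolding cube_slice_def alternating_sum_pascal[of "Suc n"]
    by (simp add: sum_divide_distrib[symmetric] mult.commute del: of_nat_Suc sum.atMost_Suc binomial_Suc_Suc)
  finally show ?thesis .
qed

text \<open>The alternating sum hides the sign; positivity is inherited from the indicator in
  dimension 0 through repeated integration.\<close>

lemma cube_slice_nonneg: "t \<ge> 0 \<Longrightarrow> cube_slice n t s \<ge> 0"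
proof (induction n arbitrary: s)
  case (Suc n)
  then show ?case
    using has_integral_nonneg[OF has_integral_cube_slice] by simp
qed (simp add: cube_slice_0)

text \<open>Confirms the volume reading of \<open>cube_slice\<close>:
  \<open>s - (\<Sum>j\<in>J. y j)\<close> is the eliminated coordinate. In the induction, fixing the
  new coordinate at \<open>u\<close> leaves the same problem with total
  \<open>s - u\<close>.\<close>

lemma nn_integral_cube_slice:
  fixes J :: "'i set" and s t :: real
  assumes "finite J" "t \<ge> 0"
  shows "(\<integral>\<^sup>+y. (\<Prod>j\<in>J. indicator {0<..t} (y j)) * indicator {0<..t} (s - (\<Sum>j\<in>J. y j))
    \<partial>Pi\<^sub>M J (\<lambda>_. lborel)) = ennreal (cube_slice (card J) t s)"
  using assms(1)
proof (induction J arbitrary: s)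
  case empty
  show ?case
    using assms(2) by (simp add: PiM_empty nn_integral_count_space_finite cube_slice_0 ennreal_indicator)
next
  case (insert m J)
  interpret product_sigma_finite "\<lambda>_::'i. lborel :: real measure" ..
  let ?I = "indicator {0<..t} :: real \<Rightarrow> ennreal"
  have "(\<integral>\<^sup>+y. (\<Prod>j\<in>insert m J. ?I (y j)) * ?I (s - (\<Sum>j\<in>insert m J. y j))
        \<partial>Pi\<^sub>M (insert m J) (\<lambda>_. lborel)) =
      (\<integral>\<^sup>+u. (\<integral>\<^sup>+y. (\<Prod>j\<in>insert m J. ?I ((y(m := u)) j)) * ?I (s - (\<Sum>j\<in>insert m J. (y(m := u)) j))
        \<partial>Pi\<^sub>M J (\<lambda>_. lborel)) \<partial>lborel)"
    by (rule product_nn_integral_insert_rev)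
      (use insert in \<open>auto intro!: borel_measurable_times_ennreal borel_measurable_prod_ennreal
        measurable_compose[OF _ borel_measurable_indicator]\<close>)
  also have "\<dots> = (\<integral>\<^sup>+u. (\<integral>\<^sup>+y. ?I u * ((\<Prod>j\<in>J. ?I (y j)) * ?I (s - u - (\<Sum>j\<in>J. y j)))
        \<partial>Pi\<^sub>M J (\<lambda>_. lborel)) \<partial>lborel)"
  proof (intro nn_integral_cong)
    fix u :: real and y :: "'i \<Rightarrow> real"
    have "(\<Prod>j\<in>J. ?I ((y(m := u)) j)) = (\<Prod>j\<in>J. ?I (y j))" "(\<Sum>j\<in>J. (y(m := u)) j) = (\<Sum>j\<in>J. y j)"
      using insert by (auto intro!: prod.cong sum.cong)
    then show "(\<Prod>j\<in>insert m J. ?I ((y(m := u)) j)) * ?I (s - (\<Sum>j\<in>insert m J. (y(m := u)) j)) =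
        ?I u * ((\<Prod>j\<in>J. ?I (y j)) * ?I (s - u - (\<Sum>j\<in>J. y j)))"
      using insert by (simp add: mult.assoc diff_diff_eq)
  qed
  also have "\<dots> = (\<integral>\<^sup>+u. ?I u * ennreal (cube_slice (card J) t (s - u)) \<partial>lborel)"
    by (subst nn_integral_cmult)
      (auto simp: insert.IH intro!: borel_measurable_times_ennreal borel_measurable_prod_ennreal
        measurable_compose[OF _ borel_measurable_indicator])
  \<comment> \<open>The closed interval matches the gauge integral of
    \<open>has_integral_cube_slice\<close>; only the null set \<open>{0}\<close> is
    affected.\<close>
  also have "\<dots> = (\<integral>\<^sup>+u. ennreal (cube_slice (card J) t (s - u)) * indicator {0..t} u \<partial>lborel)"
  proof (rule nn_integral_cong_AE)
    show "AE u in lborel. ?I u * ennreal (cube_slice (card J) t (s - u)) =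
        ennreal (cube_slice (card J) t (s - u)) * indicator {0..t} u"
      using AE_lborel_singleton[of "0::real"] by eventually_elim (auto simp: indicator_def)
  qed
  also have "\<dots> = ennreal (cube_slice (Suc (card J)) t s)"
    by (rule nn_integral_has_integral_lebesgue')
      (use assms(2) in \<open>auto intro: cube_slice_nonneg has_integral_cube_slice\<close>)
  finally show ?case
    using insert by simp
qed

section \<open>Beta integrals along the largest coordinate\<close>

text \<open>Scaling by \<open>m\<close> reduces to the Beta integral over the unit interval: the
  differential contributes \<open>1 / m\<close> and the power of \<open>u\<close> contributes
  \<open>1 / m powr a\<close>.\<close>

lemma has_integral_powr_pos_power:
  fixes a m :: real
  assumes "a > -1" "m > 0"
  shows "((\<lambda>u. u powr a * pos_power n (1 - m * u)) has_integral
    Beta (a + 1) (real n + 1) / m powr (a + 1)) {0..}"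
proof -
  have "((\<lambda>u. (m * u) powr a * (1 - m * u) powr real n) has_integral
      Beta (a + 1) (real n + 1) / m) {0..1 / m}"
    using has_integral_stretch_real[OF has_integral_Beta_real[of "a + 1" "real n + 1"], of m] assms
    by (simp add: image_divide_atLeastAtMost)
  then have "((\<lambda>u. (m * u) powr a * (1 - m * u) powr real n / m powr a) has_integral
      Beta (a + 1) (real n + 1) / m / m powr a) {0..1 / m}"
    by (rule has_integral_divide)
  also have "Beta (a + 1) (real n + 1) / m / m powr a = Beta (a + 1) (real n + 1) / m powr (a + 1)"
    using assms by (simp add: powr_add)
  \<comment> \<open>At the right endpoint \<open>u = 1 / m\<close> with \<open>n = 0\<close> both
    integrands vanish, since \<open>0 powr 0 = 0\<close> and
    \<open>pos_power 0 0 = 0\<close>.\<close>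
  finally have "((\<lambda>u. u powr a * pos_power n (1 - m * u)) has_integral
      Beta (a + 1) (real n + 1) / m powr (a + 1)) {0..1 / m}"
    by (rule has_integral_eq[rotated])
      (use assms in \<open>auto simp: powr_mult pos_power_def powr_realpow field_simps\<close>)
  \<comment> \<open>Beyond \<open>1 / m\<close> the truncated power is 0. The half-line is a domain
    independent of \<open>m\<close>, so terms with different \<open>m\<close> can be added.\<close>
  then show ?thesis
  proof (rule iffD1[OF has_integral_spike_set_eq, rotated 2])
    have "{u \<in> {0..} - {0..1 / m}. u powr a * pos_power n (1 - m * u) \<noteq> 0} = {}"
      using assms by (auto simp: pos_power_def field_simps)
    then show "negligible {u \<in> {0..} - {0..1 / m}. u powr a * pos_power n (1 - m * u) \<noteq> 0}"
      by (simp only: negligible_empty)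
    have "{u \<in> {0..1 / m} - {0..}. u powr a * pos_power n (1 - m * u) \<noteq> 0} = {}"
      by auto
    then show "negligible {u \<in> {0..1 / m} - {0..}. u powr a * pos_power n (1 - m * u) \<noteq> 0}"
      by (simp only: negligible_empty)
  qed
qed

text \<open>With side \<open>u\<close> and total \<open>1 - u\<close>, the \<open>k\<close>-th
  truncated power has argument \<open>1 - (k + 1) * u\<close>, so the previous integral applies with
  \<open>m = k + 1\<close> and the Beta factor is common to all terms.\<close>

lemma has_integral_powr_cube_slice:
  assumes "a > -1"
  shows "((\<lambda>u. u powr a * cube_slice n u (1 - u)) has_integral
    Beta (a + 1) (real n + 1) / fact n *
      (\<Sum>k\<le>Suc n. (-1) ^ k * real (Suc n choose k) / (real k + 1) powr (a + 1))) {0..}"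
proof -
  have "((\<lambda>u. (\<Sum>k\<le>Suc n. (-1) ^ k * real (Suc n choose k) *
        (u powr a * pos_power n (1 - (real k + 1) * u))) / fact n) has_integral
      (\<Sum>k\<le>Suc n. (-1) ^ k * real (Suc n choose k) *
        (Beta (a + 1) (real n + 1) / (real k + 1) powr (a + 1))) / fact n) {0..}"
    using assms
    by (intro has_integral_divide has_integral_sum has_integral_mult_right
        has_integral_powr_pos_power) auto
  moreover have "(\<Sum>k\<le>Suc n. (-1) ^ k * real (Suc n choose k) *
        (u powr a * pos_power n (1 - (real k + 1) * u))) / fact n = u powr a * cube_slice n u (1 - u)" for u
    by (simp add: cube_slice_def sum_distrib_left algebra_simps del: sum.atMost_Suc binomial_Suc_Suc)
  ultimately show ?thesis
    by (simp add: sum_distrib_left sum_divide_distrib algebra_simps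
        del: sum.atMost_Suc binomial_Suc_Suc)
qed


section \<open>The Dirichlet probability of the Voronoi region\<close>

lemma sets_simplex_lborel: "sets (simplex_lborel K) = sets (Pi\<^sub>M {1..K} (\<lambda>_. borel))"
  by (simp add: simplex_lborel_def)

lemma voronoi_region_measurable:
  assumes "i \<in> {1..K}"
  shows "voronoi_region K i \<in> sets (Pi\<^sub>M {1..K} (\<lambda>_. borel))"
proof -
  let ?P = "Pi\<^sub>M {1..K} (\<lambda>_. borel) :: (nat \<Rightarrow> real) measure"
  have comp [measurable]: "(\<lambda>x. x j) \<in> borel_measurable ?P" if "j \<in> {1..K}" for j
    using that by measurable
  have [measurable]: "Measurable.pred ?P (\<lambda>x. \<forall>j\<in>{1..K}. 0 < x j)"
    by (intro pred_intros_finite borel_measurable_pred_less comp) auto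
  have [measurable]: "Measurable.pred ?P (\<lambda>x. \<forall>j\<in>{1..K}. x j \<le> x i)"
    by (intro pred_intros_finite) (auto simp only: pred_def intro!: borel_measurable_le comp assms)
  have "voronoi_region K i = {x \<in> space ?P. (\<Sum>j=1..K. x j) = 1 \<and>
      (\<forall>j\<in>{1..K}. 0 < x j) \<and> (\<forall>j\<in>{1..K}. x j \<le> x i)}"
    unfolding voronoi_region_eq[OF assms] prob_simplex_def by (auto simp: space_PiM)
  also have "\<dots> \<in> sets ?P"
    by measurable
  finally show ?thesis .
qed

lemma dirichlet_density_vertex:
  assumes "i \<in> {1..K}" "x \<in> prob_simplex K" "a > -1"
  shows "dirichlet_density K (\<lambda>l. 1 + a * std_basis K i l) x =
    Gamma (real K + a) / Gamma (1 + a) * x i powr a"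
proof -
  \<comment> \<open>Positivity matters for the factors with exponent 0, because
    \<open>0 powr 0\<close> is 0 rather than 1.\<close>
  have "x j \<noteq> 0" if "j \<in> {1..K}" for j
    using assms(2) that by (force simp: prob_simplex_def)
  then have "(\<Prod>j=1..K. x j powr (1 + a * std_basis K i j - 1)) = (\<Prod>j=1..K. if j = i then x i powr a else 1)"
    by (intro prod.cong) (auto simp: std_basis_def)
  moreover have "(\<Prod>j=1..K. Gamma (1 + a * std_basis K i j)) = (\<Prod>j=1..K. if j = i then Gamma (1 + a) else 1)"
    by (intro prod.cong) (auto simp: std_basis_def)
  moreover have "(\<Sum>j=1..K. 1 + a * std_basis K i j) = (\<Sum>j=1..K. 1 + (if j = i then a else 0))"
    by (intro sum.cong) (auto simp: std_basis_def)
  ultimately show ?thesis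
    using assms(1,2) by (simp add: dirichlet_density_def multivariate_Beta_def sum.distrib)
qed

lemma nn_integral_voronoi_region:
  assumes K: "K \<ge> 2" and i: "i \<in> {1..K}"
  shows "(\<integral>\<^sup>+x. ennreal (x i powr a) * indicator (voronoi_region K i) x \<partial>simplex_lborel K) =
    (\<integral>\<^sup>+u. ennreal (u powr a * cube_slice (K - 2) u (1 - u)) * indicator {0..} u \<partial>lborel)"
proof -
  interpret product_sigma_finite "\<lambda>_::nat. lborel :: real measure" ..
  let ?P = "Pi\<^sub>M {1..K} (\<lambda>_. borel) :: (nat \<Rightarrow> real) measure"
  \<comment> \<open>The eliminated coordinate must differ from \<open>i\<close> to keep
    \<open>x i\<close> free; \<open>K \<ge> 2\<close> provides one.\<close>
  obtain r where r: "r \<in> {1..K}" "r \<noteq> i"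
    using K i by (cases "i = 1") (auto intro: that[of 1] that[of 2])
  define J where "J = {1..K} - {i, r}"
  have J: "finite J" "i \<notin> J" "r \<notin> J" "{1..K} - {r} = insert i J" "{1..K} = insert r (insert i J)"
    "card J = K - 2"
    using r i by (auto simp: J_def card_Diff_subset)
  let ?F = "\<lambda>x. ennreal (x i powr a) * indicator (voronoi_region K i) x"
  have F: "?F \<in> borel_measurable ?P"
    using voronoi_region_measurable[OF i] i by measurable
  \<comment> \<open>Once \<open>x i = u\<close> is fixed, membership in the region says that the
    \<open>K - 2\<close> coordinates in \<open>J\<close> and the eliminated one all lie in
    \<open>{0<..u}\<close>: the integrand of \<open>nn_integral_cube_slice\<close> with side
    \<open>u\<close> and total \<open>1 - u\<close>.\<close>
  have slice: "?F (y(i := u, r := 1 - (\<Sum>j\<in>insert i J. (y(i := u)) j))) =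
      ennreal (u powr a) * indicator {0..} u *
        ((\<Prod>j\<in>J. indicator {0<..u} (y j)) * indicator {0<..u} (1 - u - (\<Sum>j\<in>J. y j)))"
    if y: "y \<in> space (Pi\<^sub>M J (\<lambda>_. lborel))" for y :: "nat \<Rightarrow> real" and u :: real
  proof (cases "u = 0")
    case False
    let ?x = "y(i := u, r := 1 - u - (\<Sum>j\<in>J. y j))"
    have eq: "(\<Sum>j\<in>insert i J. (y(i := u)) j) = u + (\<Sum>j\<in>J. y j)"
      by (rule sum_fun_upd_insert[OF J(1,2)])
    have sum1: "(\<Sum>j\<in>insert r (insert i J). ?x j) = 1"
      using sum_fun_upd_insert[of "insert i J" r "y(i := u)"] J(1,3) r(2) eq by (simp only:) simp
    have "?x \<in> voronoi_region K i \<longleftrightarrow>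
        (0 < u \<and> (\<forall>j\<in>J. y j \<in> {0<..u}) \<and> 1 - u - (\<Sum>j\<in>J. y j) \<in> {0<..u})"
    proof -
      have ext: "?x \<in> insert r (insert i J) \<rightarrow>\<^sub>E UNIV"
        using y by (auto simp: space_PiM PiE_def extensional_def)
      have "(\<forall>j\<in>insert r (insert i J). 0 < ?x j) \<longleftrightarrow>
          0 < u \<and> (\<forall>j\<in>J. 0 < y j) \<and> 0 < 1 - u - (\<Sum>j\<in>J. y j)"
        using J r by auto
      moreover have "(\<forall>j\<in>insert r (insert i J). ?x j \<le> ?x i) \<longleftrightarrow>
          (\<forall>j\<in>J. y j \<le> u) \<and> 1 - u - (\<Sum>j\<in>J. y j) \<le> u"
        using J r by auto
      ultimately show ?thesis
        unfolding voronoi_region_eq[OF i] prob_simplex_def J(5) mem_Collect_eq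
        using ext sum1 by auto
    qed
    moreover have "(\<Prod>j\<in>J. indicator {0<..u} (y j) :: ennreal) = of_bool (\<forall>j\<in>J. y j \<in> {0<..u})"
      using J(1) by (induction J rule: finite_induct) (auto simp: indicator_def)
    ultimately show ?thesis
      using r False unfolding eq by (auto simp: indicator_def diff_diff_eq)
  qed (use r in simp)
  have "(\<integral>\<^sup>+x. ?F x \<partial>simplex_lborel K) =
      (\<integral>\<^sup>+y. ?F (y(r := 1 - (\<Sum>j\<in>insert i J. y j))) \<partial>Pi\<^sub>M (insert i J) (\<lambda>_. lborel))"
    using nn_integral_simplex_lborel[OF r(1) F] by (simp only: J(4))
  also have "\<dots> = (\<integral>\<^sup>+u. (\<integral>\<^sup>+y. ?F (y(i := u, r := 1 - (\<Sum>j\<in>insert i J. (y(i := u)) j)))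
      \<partial>Pi\<^sub>M J (\<lambda>_. lborel)) \<partial>lborel)"
  proof (rule product_nn_integral_insert_rev)
    have "(\<lambda>y. y(r := 1 - (\<Sum>j\<in>insert i J. y j))) \<in> Pi\<^sub>M (insert i J) (\<lambda>_. lborel) \<rightarrow>\<^sub>M ?P"
      by (rule measurable_fun_upd[where J = "insert i J"])
        (use J in \<open>auto intro!: measurable_PiM_single'\<close>)
    from measurable_compose[OF this F]
    show "(\<lambda>y. ?F (y(r := 1 - (\<Sum>j\<in>insert i J. y j)))) \<in> borel_measurable (Pi\<^sub>M (insert i J) (\<lambda>_. lborel))" .
  qed (use J in auto)
  also have "\<dots> = (\<integral>\<^sup>+u. (\<integral>\<^sup>+y. ennreal (u powr a) * indicator {0..} u *
      ((\<Prod>j\<in>J. indicator {0<..u} (y j)) * indicator {0<..u} (1 - u - (\<Sum>j\<in>J. y j)))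
      \<partial>Pi\<^sub>M J (\<lambda>_. lborel)) \<partial>lborel)"
    by (intro nn_integral_cong slice)
  also have "\<dots> = (\<integral>\<^sup>+u. ennreal (u powr a) * indicator {0..} u *
      (\<integral>\<^sup>+y. (\<Prod>j\<in>J. indicator {0<..u} (y j)) * indicator {0<..u} (1 - u - (\<Sum>j\<in>J. y j))
      \<partial>Pi\<^sub>M J (\<lambda>_. lborel)) \<partial>lborel)"
    by (intro nn_integral_cong nn_integral_cmult)
      (auto intro!: borel_measurable_times_ennreal borel_measurable_prod_ennreal
        measurable_compose[OF _ borel_measurable_indicator])
  also have "\<dots> = (\<integral>\<^sup>+u. ennreal (u powr a * cube_slice (K - 2) u (1 - u)) * indicator {0..} u \<partial>lborel)"
  proof (intro nn_integral_cong)
    fix u :: real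
    show "ennreal (u powr a) * indicator {0..} u *
        (\<integral>\<^sup>+y. (\<Prod>j\<in>J. indicator {0<..u} (y j)) * indicator {0<..u} (1 - u - (\<Sum>j\<in>J. y j))
        \<partial>Pi\<^sub>M J (\<lambda>_. lborel)) =
        ennreal (u powr a * cube_slice (K - 2) u (1 - u)) * indicator {0..} u"
      using J nn_integral_cube_slice[of J u "1 - u"]
      by (cases "u \<ge> 0") (auto simp: ennreal_mult cube_slice_nonneg)
  qed
  finally show ?thesis .
qed

theorem proposition3p1:
  fixes K i :: nat and a :: real
    and M :: "'a measure" and X :: "'a \<Rightarrow> nat \<Rightarrow> real"
  assumes "K \<ge> 2" and "i \<in> {1..K}" and "a \<ge> 0"
    and "prob_space M"
    and "distributed M (simplex_lborel K) X
           (dirichlet_density K (\<lambda>l. 1 + a * std_basis K i l))"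
  shows "measure M {\<omega> \<in> space M. X \<omega> \<in> voronoi_region K i}
       = (\<Sum>k=0..K - 1. (-1) ^ k * real ((K - 1) choose k) / (real k + 1) powr (a + 1))"
proof -
  let ?V = "voronoi_region K i" and ?f = "dirichlet_density K (\<lambda>l. 1 + a * std_basis K i l)"
  let ?g = "\<lambda>u. u powr a * cube_slice (K - 2) u (1 - u)"
  \<comment> \<open>The reciprocal of the Dirichlet normalizing constant: all parameters are 1
    except one equal to \<open>1 + a\<close>, and they add up to \<open>K + a\<close>.\<close>
  define C where "C = Gamma (real K + a) / Gamma (1 + a)"
  define S where "S = (\<Sum>k=0..K - 1. (-1) ^ k * real ((K - 1) choose k) / (real k + 1) powr (a + 1))"
  have K: "Suc (K - 2) = K - 1"
    using assms(1) by auto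
  have "Gamma (1 + a) > 0" "Gamma (real K + a) > 0"
    using assms(1,3) by (auto intro!: Gamma_real_pos)
  then have C: "C > 0"
    by (simp add: C_def)
  define B where "B = Beta (a + 1) (real (K - 2) + 1) / fact (K - 2)"
  \<comment> \<open>\<open>B\<close> is the common Beta factor over \<open>fact (K - 2)\<close>. Its
    two Beta arguments add up to \<open>K + a\<close>, and the Gamma value at \<open>K - 1\<close>
    is this factorial, so \<open>C * B = 1\<close>.\<close>
  have CBS: "C * (B * S) = S"
  proof -
    have "a + 1 + (real (K - 2) + 1) = real K + a"
      using assms(1) by simp
    then have "Beta (a + 1) (real (K - 2) + 1) =
        Gamma (1 + a) * fact (K - 2) / Gamma (real K + a)"
      by (simp only: Beta_def Gamma_fact[symmetric] add.commute[of a 1]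
          add.commute[of "real (K - 2)" 1])
    then show ?thesis
      using \<open>Gamma (1 + a) > 0\<close> \<open>Gamma (real K + a) > 0\<close> by (simp add: C_def B_def)
  qed
  have "(?g has_integral B * S) {0..}"
    using has_integral_powr_cube_slice[of a "K - 2"] assms(3)
    by (simp only: S_def B_def K atLeast0AtMost)
  moreover have "?g u \<ge> 0" if "u \<in> {0..}" for u
    using that by (simp add: cube_slice_nonneg)
  ultimately have int: "(\<integral>\<^sup>+u. ennreal (?g u) * indicator {0..} u \<partial>lborel) = ennreal (B * S)"
    and "B * S \<ge> 0"
    by (auto intro: nn_integral_has_integral_lebesgue' has_integral_nonneg)
  \<comment> \<open>Not evident from the alternating sum. It is needed because
    \<open>ennreal\<close> sends negative reals to 0, so \<open>S\<close> could not otherwise be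
    recovered from \<open>ennreal S\<close>.\<close>
  then have "S \<ge> 0"
    using C CBS by (metis less_imp_le mult_nonneg_nonneg)
  have V: "?V \<in> sets (simplex_lborel K)"
    using voronoi_region_measurable[OF assms(2)] by (simp add: sets_simplex_lborel)
  have meas: "(\<lambda>x. ennreal (x i powr a) * indicator ?V x) \<in> borel_measurable (simplex_lborel K)"
    using voronoi_region_measurable[OF assms(2)] assms(2)
    unfolding measurable_cong_sets[OF sets_simplex_lborel refl] by measurable
  have "{\<omega> \<in> space M. X \<omega> \<in> ?V} = X -` ?V \<inter> space M"
    by auto
  then have "emeasure M {\<omega> \<in> space M. X \<omega> \<in> ?V} =
      (\<integral>\<^sup>+x. ennreal (?f x) * indicator ?V x \<partial>simplex_lborel K)"
    using distributed_emeasure[OF assms(5) V] by simp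
  also have "\<dots> = (\<integral>\<^sup>+x. ennreal C * (ennreal (x i powr a) * indicator ?V x) \<partial>simplex_lborel K)"
  proof (intro nn_integral_cong)
    fix x
    have "?f x = C * x i powr a" if "x \<in> ?V"
      using dirichlet_density_vertex[OF assms(2), of x a] assms(2,3) that
      by (simp add: voronoi_region_eq C_def)
    then show "ennreal (?f x) * indicator ?V x = ennreal C * (ennreal (x i powr a) * indicator ?V x)"
      using C by (cases "x \<in> ?V") (simp_all add: ennreal_mult')
  qed
  also have "\<dots> = ennreal C * (\<integral>\<^sup>+u. ennreal (?g u) * indicator {0..} u \<partial>lborel)"
    by (simp add: nn_integral_cmult[OF meas] nn_integral_voronoi_region[OF assms(1,2)])
  also have "\<dots> = ennreal S"
    using C by (simp only: int ennreal_mult'[symmetric] less_imp_le CBS)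
  finally show ?thesis
    using \<open>S \<ge> 0\<close> by (simp add: measure_def S_def)
qed

end
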